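(* Let $K$ be a field, $\lambda\in K$. Let $(C,\Delta,\varepsilon,\alpha_C,\beta_C,\psi_C,\omega_C,\sigma)$ be a coquasitriangular counitary $\lambda$-infBH-bialgebra and let $(M,\varphi,\psi_M,\omega_M)$ be a right $(C,\Delta,\psi_C,\omega_C)$-comodule, with $\omega_M$ invertible and $\varphi(m)=m_{(0)}\otimes m_{(1)}$. Let $\alpha_M,\beta_M:M\to M$ be linear maps such that $\alpha_M\omega_M=\omega_M\alpha_M$ and $\varphi\alpha_M=(\alpha_M\otimes\alpha_C)\varphi$. Then $(M,\nu,\varphi,\alpha_M,\beta_M,\psi_M,\omega_M)$ is a right $\lambda$-infBH-Hopf module over $C$ (with multiplication $\mu_\sigma$), where the action $\nu:M\otimes C\to M$ is given by $$\nu(m\otimes c)=\alpha_M\omega_M^{-1}(m_{(0)})\,\sigma(m_{(1)},\psi_C(c))-\lambda\,\varepsilon(c)\,\alpha_M(m),\qquad c\in C,\ m\in M.$$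
   Context: Everything is over the field $K$; $\Delta(c)=c_1\otimes c_2$. BiHom-coassociative coalgebra $(C,\Delta,\psi,\omega)$: $\psi\omega=\omega\psi$, $(\psi\otimes\psi)\Delta=\Delta\psi$, $(\omega\otimes\omega)\Delta=\Delta\omega$, $(\Delta\otimes\psi)\Delta=(\omega\otimes\Delta)\Delta$. Counitary: there is linear $\varepsilon:C\to K$ with $\varepsilon\psi=\varepsilon\omega=\varepsilon$, $(\mathrm{id}\otimes\varepsilon)\Delta=\omega$, $(\varepsilon\otimes\mathrm{id})\Delta=\psi$. Coquasitriangular counitary $\lambda$-infBH-bialgebra ($\lambda$-infinitesimal BiHom-bialgebra) $(C,\Delta,\varepsilon,\alpha,\beta,\psi,\omega,\sigma)$: $(C,\Delta,\varepsilon,\psi,\omega)$ is a counitary BiHom-coassociative coalgebra with $\psi,\omega$ bijective; $\alpha,\beta:C\to C$ are linear, each commutes with $\psi$ and with $\omega$, and $\varepsilon\alpha=\varepsilon\beta=\varepsilon$; $\sigma\in(C\otimes C)^*$ satisfies $\sigma(f(c),f(d))=\sigma(c,d)$ for $f\in\{\alpha,\beta,\psi,\omega\}$, and for all $c,d,e\in C$ $$\sigma(\alpha(c_1),\beta\omega(e))\sigma(c_2,\psi(d))-\sigma(\omega(c),d_1)\sigma(d_2,\psi(e))+\sigma(\omega(d),e_1)\sigma(\alpha\psi(c),\beta(e_2))=\lambda\,\sigma(\alpha(c),\beta(e))\varepsilon(d).$$ Its multiplication is $cd=\mu_\sigma(c\otimes d)=\alpha\omega^{-1}(c_1)\sigma(c_2,\psi(d))-\sigma(\omega(c),d_1)\beta\psi^{-1}(d_2)-\lambda\,\alpha(c)\varepsilon(d)$,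 and $\psi,\omega$ are required to be multiplicative for it. Right comodule $(M,\varphi,\psi_M,\omega_M)$, $\varphi:M\to M\otimes C$: $\psi_M\omega_M=\omega_M\psi_M$; $(g_M\otimes g_C)\varphi=\varphi g_M$ for $g\in\{\psi,\omega\}$; $(\omega_M\otimes\Delta)\varphi=(\varphi\otimes\psi_C)\varphi$. Right module $(M,\triangleleft,\alpha_M,\beta_M)$ over $(C,\mu,\alpha_C,\beta_C)$: $\alpha_M\beta_M=\beta_M\alpha_M$; $f_M(m\triangleleft c)=f_M(m)\triangleleft f_C(c)$ for $f\in\{\alpha,\beta\}$; $\alpha_M(m)\triangleleft(cd)=(m\triangleleft c)\triangleleft\beta_C(d)$. Right $\lambda$-infBH-Hopf module $(M,\triangleleft,\varphi,\alpha_M,\beta_M,\psi_M,\omega_M)$: a right module and a right comodule, any two of $\alpha_M,\beta_M,\psi_M,\omega_M$ commute, and $\varphi(m\triangleleft c)=\omega_M(m)\triangleleft c_1\otimes\beta_C(c_2)+\alpha_M(m_{(0)})\otimes m_{(1)}\psi_C(c)+\lambda\,\alpha_M\omega_M(m)\otimes\beta_C\psi_C(c)$. Here $m\triangleleft c=\nu(m\otimes c)$.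
   Formalization: The formal theorem adds hypotheses without which the claim fails: α_M commutes with β_M and ψ_M, β_M commutes with ψ_M and ω_M, and φβ_M=(β_M⊗β_C)φ. *)

theory Defs
  imports Complex_Main "HOL-Library.Poly_Mapping"
begin

text \<open>Vector spaces over a field \<open>'k\<close> are given, as in \<open>HOL.Vector_Spaces\<close>, by a type and a
  scaling. The tensor product of \<open>A\<close> and \<open>B\<close> is the quotient of the free vector space
  \<open>'a \<times> 'b \<Rightarrow>\<^sub>0 'k\<close> by the subspace generated by the bilinearity relations; its elements
  are the cosets of that subspace. The threefold product is built in the same way from trilinearity
  relations, which identifies \<open>(A \<otimes> B) \<otimes> C\<close> with \<open>A \<otimes> (B \<otimes> C)\<close> as the
  BiHom-(co)associativity axioms require.\<close>

definition free_scale :: "'k::field \<Rightarrow> ('x \<Rightarrow>\<^sub>0 'k) \<Rightarrow> ('x \<Rightarrow>\<^sub>0 'k)"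
  where "free_scale k p = Poly_Mapping.map ((*) k) p"

abbreviation gen :: "'x \<Rightarrow> ('x \<Rightarrow>\<^sub>0 'k::field)"
  where "gen x \<equiv> Poly_Mapping.single x 1"

definition tensor_null ::
  "('k::field \<Rightarrow> 'a::ab_group_add \<Rightarrow> 'a) \<Rightarrow> ('k \<Rightarrow> 'b::ab_group_add \<Rightarrow> 'b)
    \<Rightarrow> ('a \<times> 'b \<Rightarrow>\<^sub>0 'k) set"
  where "tensor_null sA sB = module.span free_scale
    ({gen (a + a', b) - gen (a, b) - gen (a', b) | a a' b. True}
     \<union> {gen (a, b + b') - gen (a, b) - gen (a, b') | a b b'. True}
     \<union> {gen (sA k a, b) - free_scale k (gen (a, b)) | k a b. True}
     \<union> {gen (a, sB k b) - free_scale k (gen (a, b)) | k a b. True})"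

definition tensor_null3 ::
  "('k::field \<Rightarrow> 'a::ab_group_add \<Rightarrow> 'a) \<Rightarrow> ('k \<Rightarrow> 'b::ab_group_add \<Rightarrow> 'b)
    \<Rightarrow> ('k \<Rightarrow> 'c::ab_group_add \<Rightarrow> 'c) \<Rightarrow> ('a \<times> 'b \<times> 'c \<Rightarrow>\<^sub>0 'k) set"
  where "tensor_null3 sA sB sC = module.span free_scale
    ({gen (a + a', b, c) - gen (a, b, c) - gen (a', b, c) | a a' b c. True}
     \<union> {gen (a, b + b', c) - gen (a, b, c) - gen (a, b', c) | a b b' c. True}
     \<union> {gen (a, b, c + c') - gen (a, b, c) - gen (a, b, c') | a b c c'. True}
     \<union> {gen (sA k a, b, c) - free_scale k (gen (a, b, c)) | k a b c. True}
     \<union> {gen (a, sB k b, c) - free_scale k (gen (a, b, c)) | k a b c. True}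
     \<union> {gen (a, b, sC k c) - free_scale k (gen (a, b, c)) | k a b c. True})"

type_synonym ('a, 'b, 'k) tensor = "('a \<times> 'b \<Rightarrow>\<^sub>0 'k) set"
type_synonym ('a, 'b, 'c, 'k) tensor3 = "('a \<times> 'b \<times> 'c \<Rightarrow>\<^sub>0 'k) set"

definition tensor_class ::
  "('k::field \<Rightarrow> 'a::ab_group_add \<Rightarrow> 'a) \<Rightarrow> ('k \<Rightarrow> 'b::ab_group_add \<Rightarrow> 'b)
    \<Rightarrow> ('a \<times> 'b \<Rightarrow>\<^sub>0 'k) \<Rightarrow> ('a, 'b, 'k) tensor"
  where "tensor_class sA sB p = {q. q - p \<in> tensor_null sA sB}"

definition tensor_class3 ::
  "('k::field \<Rightarrow> 'a::ab_group_add \<Rightarrow> 'a) \<Rightarrow> ('k \<Rightarrow> 'b::ab_group_add \<Rightarrow> 'b)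
    \<Rightarrow> ('k \<Rightarrow> 'c::ab_group_add \<Rightarrow> 'c) \<Rightarrow> ('a \<times> 'b \<times> 'c \<Rightarrow>\<^sub>0 'k)
    \<Rightarrow> ('a, 'b, 'c, 'k) tensor3"
  where "tensor_class3 sA sB sC p = {q. q - p \<in> tensor_null3 sA sB sC}"

definition tensor_space ::
  "('k::field \<Rightarrow> 'a::ab_group_add \<Rightarrow> 'a) \<Rightarrow> ('k \<Rightarrow> 'b::ab_group_add \<Rightarrow> 'b)
    \<Rightarrow> ('a, 'b, 'k) tensor set"
  where "tensor_space sA sB = range (tensor_class sA sB)"

text \<open>A representative of a coset. Everything below that is computed from it is used only where
  the result does not depend on the choice.\<close>

definition tensor_rep :: "('a, 'b, 'k::field) tensor \<Rightarrow> ('a \<times> 'b \<Rightarrow>\<^sub>0 'k)"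
  where "tensor_rep X = (SOME p. p \<in> X)"

definition tensor_add ::
  "('k::field \<Rightarrow> 'a::ab_group_add \<Rightarrow> 'a) \<Rightarrow> ('k \<Rightarrow> 'b::ab_group_add \<Rightarrow> 'b)
    \<Rightarrow> ('a, 'b, 'k) tensor \<Rightarrow> ('a, 'b, 'k) tensor \<Rightarrow> ('a, 'b, 'k) tensor"
  where "tensor_add sA sB X Y = tensor_class sA sB (tensor_rep X + tensor_rep Y)"

definition tensor_scale ::
  "('k::field \<Rightarrow> 'a::ab_group_add \<Rightarrow> 'a) \<Rightarrow> ('k \<Rightarrow> 'b::ab_group_add \<Rightarrow> 'b)
    \<Rightarrow> 'k \<Rightarrow> ('a, 'b, 'k) tensor \<Rightarrow> ('a, 'b, 'k) tensor"
  where "tensor_scale sA sB k X = tensor_class sA sB (free_scale k (tensor_rep X))"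

definition pure_tensor ::
  "('k::field \<Rightarrow> 'a::ab_group_add \<Rightarrow> 'a) \<Rightarrow> ('k \<Rightarrow> 'b::ab_group_add \<Rightarrow> 'b)
    \<Rightarrow> 'a \<Rightarrow> 'b \<Rightarrow> ('a, 'b, 'k) tensor"
  where "pure_tensor sA sB a b = tensor_class sA sB (gen (a, b))"

definition linear_to_tensor ::
  "('k::field \<Rightarrow> 'v::ab_group_add \<Rightarrow> 'v)
    \<Rightarrow> ('k \<Rightarrow> 'a::ab_group_add \<Rightarrow> 'a) \<Rightarrow> ('k \<Rightarrow> 'b::ab_group_add \<Rightarrow> 'b)
    \<Rightarrow> ('v \<Rightarrow> ('a, 'b, 'k) tensor) \<Rightarrow> bool"
  where "linear_to_tensor sV sA sB f \<longleftrightarrow>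
    (\<forall>v. f v \<in> tensor_space sA sB)
    \<and> (\<forall>v w. f (v + w) = tensor_add sA sB (f v) (f w))
    \<and> (\<forall>k v. f (sV k v) = tensor_scale sA sB k (f v))"

definition bilinear_map ::
  "('k::field \<Rightarrow> 'a::ab_group_add \<Rightarrow> 'a) \<Rightarrow> ('k \<Rightarrow> 'b::ab_group_add \<Rightarrow> 'b)
    \<Rightarrow> ('k \<Rightarrow> 'v::ab_group_add \<Rightarrow> 'v) \<Rightarrow> ('a \<Rightarrow> 'b \<Rightarrow> 'v) \<Rightarrow> bool"
  where "bilinear_map sA sB sV F \<longleftrightarrow>
    (\<forall>a. Vector_Spaces.linear sB sV (F a))
    \<and> (\<forall>b. Vector_Spaces.linear sA sV (\<lambda>a. F a b))"

text \<open>\<open>tensor_sum sV F X\<close> is the Sweedler-style sum \<open>\<Sum> F a b\<close> over \<open>X = \<Sum> a \<otimes> b\<close>,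
  i.e. the value at \<open>X\<close> of the linear map induced by \<open>F\<close>, for \<open>F\<close> bilinear (or, when the target
  is a free vector space, bilinear up to the tensor relations there). Linear maps out of a tensor
  product are accordingly written as curried bilinear maps.\<close>

definition tensor_sum ::
  "('k::field \<Rightarrow> 'v::ab_group_add \<Rightarrow> 'v) \<Rightarrow> ('a \<Rightarrow> 'b \<Rightarrow> 'v) \<Rightarrow> ('a, 'b, 'k) tensor \<Rightarrow> 'v"
  where "tensor_sum sV F X =
    (let p = tensor_rep X
     in \<Sum>(a, b)\<in>Poly_Mapping.keys p. sV (Poly_Mapping.lookup p (a, b)) (F a b))"

text \<open>\<open>f \<otimes> g\<close>, with values in the tensor product of the spaces scaled by \<open>sA\<close> and \<open>sB\<close>.\<close>

definition tensor_map ::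
  "('k::field \<Rightarrow> 'a::ab_group_add \<Rightarrow> 'a) \<Rightarrow> ('k \<Rightarrow> 'b::ab_group_add \<Rightarrow> 'b)
    \<Rightarrow> ('x \<Rightarrow> 'a) \<Rightarrow> ('y \<Rightarrow> 'b) \<Rightarrow> ('x, 'y, 'k) tensor \<Rightarrow> ('a, 'b, 'k) tensor"
  where "tensor_map sA sB f g X =
    tensor_class sA sB (tensor_sum free_scale (\<lambda>x y. gen (f x, g y)) X)"

text \<open>\<open>h \<otimes> g\<close> for \<open>h\<close> with values in a tensor product, and \<open>f \<otimes> h\<close> likewise.\<close>

definition tensor_map_left ::
  "('k::field \<Rightarrow> 'a::ab_group_add \<Rightarrow> 'a) \<Rightarrow> ('k \<Rightarrow> 'b::ab_group_add \<Rightarrow> 'b)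
    \<Rightarrow> ('k \<Rightarrow> 'c::ab_group_add \<Rightarrow> 'c) \<Rightarrow> ('x \<Rightarrow> ('a, 'b, 'k) tensor) \<Rightarrow> ('y \<Rightarrow> 'c)
    \<Rightarrow> ('x, 'y, 'k) tensor \<Rightarrow> ('a, 'b, 'c, 'k) tensor3"
  where "tensor_map_left sA sB sC h g X =
    tensor_class3 sA sB sC
      (tensor_sum free_scale
        (\<lambda>x y. tensor_sum free_scale (\<lambda>a b. gen (a, b, g y)) (h x)) X)"

definition tensor_map_right ::
  "('k::field \<Rightarrow> 'a::ab_group_add \<Rightarrow> 'a) \<Rightarrow> ('k \<Rightarrow> 'b::ab_group_add \<Rightarrow> 'b)
    \<Rightarrow> ('k \<Rightarrow> 'c::ab_group_add \<Rightarrow> 'c) \<Rightarrow> ('x \<Rightarrow> 'a) \<Rightarrow> ('y \<Rightarrow> ('b, 'c, 'k) tensor)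
    \<Rightarrow> ('x, 'y, 'k) tensor \<Rightarrow> ('a, 'b, 'c, 'k) tensor3"
  where "tensor_map_right sA sB sC f h X =
    tensor_class3 sA sB sC
      (tensor_sum free_scale
        (\<lambda>x y. tensor_sum free_scale (\<lambda>b c. gen (f x, b, c)) (h y)) X)"

locale bihom_coalgebra =
  fixes s :: "'k::field \<Rightarrow> 'c::ab_group_add \<Rightarrow> 'c"
    and \<Delta> :: "'c \<Rightarrow> ('c, 'c, 'k) tensor"
    and \<psi> \<omega> :: "'c \<Rightarrow> 'c"
  assumes vector_space: "vector_space s"
    and comult_linear: "linear_to_tensor s s s \<Delta>"
    and psi_linear: "Vector_Spaces.linear s s \<psi>"
    and omega_linear: "Vector_Spaces.linear s s \<omega>"
    and psi_omega: "\<psi> \<circ> \<omega> = \<omega> \<circ> \<psi>"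
    and psi_comult: "tensor_map s s \<psi> \<psi> (\<Delta> c) = \<Delta> (\<psi> c)"
    and omega_comult: "tensor_map s s \<omega> \<omega> (\<Delta> c) = \<Delta> (\<omega> c)"
    and coassoc: "tensor_map_left s s s \<Delta> \<psi> (\<Delta> c) = tensor_map_right s s s \<omega> \<Delta> (\<Delta> c)"

locale counitary_bihom_coalgebra = bihom_coalgebra s \<Delta> \<psi> \<omega>
  for s :: "'k::field \<Rightarrow> 'c::ab_group_add \<Rightarrow> 'c"
    and \<Delta> :: "'c \<Rightarrow> ('c, 'c, 'k) tensor"
    and \<epsilon> :: "'c \<Rightarrow> 'k"
    and \<psi> \<omega> :: "'c \<Rightarrow> 'c" +
  assumes counit_linear: "Vector_Spaces.linear s (*) \<epsilon>"
    and counit_psi: "\<epsilon> (\<psi> c) = \<epsilon> c"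
    and counit_omega: "\<epsilon> (\<omega> c) = \<epsilon> c"
    and counit_right: "tensor_sum s (\<lambda>x y. s (\<epsilon> y) x) (\<Delta> c) = \<omega> c"
    and counit_left: "tensor_sum s (\<lambda>x y. s (\<epsilon> x) y) (\<Delta> c) = \<psi> c"

definition mu_sigma ::
  "'k::field \<Rightarrow> ('k \<Rightarrow> 'c::ab_group_add \<Rightarrow> 'c) \<Rightarrow> ('c \<Rightarrow> ('c, 'c, 'k) tensor) \<Rightarrow> ('c \<Rightarrow> 'k)
    \<Rightarrow> ('c \<Rightarrow> 'c) \<Rightarrow> ('c \<Rightarrow> 'c) \<Rightarrow> ('c \<Rightarrow> 'c) \<Rightarrow> ('c \<Rightarrow> 'c)
    \<Rightarrow> ('c \<Rightarrow> 'c \<Rightarrow> 'k) \<Rightarrow> 'c \<Rightarrow> 'c \<Rightarrow> 'c"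
  where "mu_sigma l s \<Delta> \<epsilon> \<alpha> \<beta> \<psi> \<omega> \<sigma> c d =
    tensor_sum s (\<lambda>c1 c2. s (\<sigma> c2 (\<psi> d)) (\<alpha> (inv \<omega> c1))) (\<Delta> c)
    - tensor_sum s (\<lambda>d1 d2. s (\<sigma> (\<omega> c) d1) (\<beta> (inv \<psi> d2))) (\<Delta> d)
    - s (l * \<epsilon> d) (\<alpha> c)"

text \<open>In the locales below, the scalar \<open>l\<close> is the parameter \<open>\<lambda>\<close> of the theory.\<close>

locale coquasitriangular_infBH_bialgebra = counitary_bihom_coalgebra s \<Delta> \<epsilon> \<psi> \<omega>
  for l :: "'k::field"
    and s :: "'k \<Rightarrow> 'c::ab_group_add \<Rightarrow> 'c"
    and \<Delta> :: "'c \<Rightarrow> ('c, 'c, 'k) tensor"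
    and \<epsilon> :: "'c \<Rightarrow> 'k"
    and \<alpha> \<beta> \<psi> \<omega> :: "'c \<Rightarrow> 'c"
    and \<sigma> :: "'c \<Rightarrow> 'c \<Rightarrow> 'k" +
  assumes psi_bij: "bij \<psi>"
    and omega_bij: "bij \<omega>"
    and alpha_linear: "Vector_Spaces.linear s s \<alpha>"
    and beta_linear: "Vector_Spaces.linear s s \<beta>"
    and alpha_psi: "\<alpha> \<circ> \<psi> = \<psi> \<circ> \<alpha>"
    and alpha_omega: "\<alpha> \<circ> \<omega> = \<omega> \<circ> \<alpha>"
    and beta_psi: "\<beta> \<circ> \<psi> = \<psi> \<circ> \<beta>"
    and beta_omega: "\<beta> \<circ> \<omega> = \<omega> \<circ> \<beta>"
    and counit_alpha: "\<epsilon> (\<alpha> c) = \<epsilon> c"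
    and counit_beta: "\<epsilon> (\<beta> c) = \<epsilon> c"
    and sigma_bilinear: "bilinear_map s s (*) \<sigma>"
    and sigma_invariant: "f \<in> {\<alpha>, \<beta>, \<psi>, \<omega>} \<Longrightarrow> \<sigma> (f c) (f d) = \<sigma> c d"
    and sigma_yang_baxter:
      "tensor_sum (*) (\<lambda>c1 c2. \<sigma> (\<alpha> c1) (\<beta> (\<omega> e)) * \<sigma> c2 (\<psi> d)) (\<Delta> c)
       - tensor_sum (*) (\<lambda>d1 d2. \<sigma> (\<omega> c) d1 * \<sigma> d2 (\<psi> e)) (\<Delta> d)
       + tensor_sum (*) (\<lambda>e1 e2. \<sigma> (\<omega> d) e1 * \<sigma> (\<alpha> (\<psi> c)) (\<beta> e2)) (\<Delta> e)
       = l * \<sigma> (\<alpha> c) (\<beta> e) * \<epsilon> d"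
    and psi_mult:
      "\<psi> (mu_sigma l s \<Delta> \<epsilon> \<alpha> \<beta> \<psi> \<omega> \<sigma> c d)
       = mu_sigma l s \<Delta> \<epsilon> \<alpha> \<beta> \<psi> \<omega> \<sigma> (\<psi> c) (\<psi> d)"
    and omega_mult:
      "\<omega> (mu_sigma l s \<Delta> \<epsilon> \<alpha> \<beta> \<psi> \<omega> \<sigma> c d)
       = mu_sigma l s \<Delta> \<epsilon> \<alpha> \<beta> \<psi> \<omega> \<sigma> (\<omega> c) (\<omega> d)"

locale right_comodule = C: bihom_coalgebra sC \<Delta> \<psi>C \<omega>C
  for sC :: "'k::field \<Rightarrow> 'c::ab_group_add \<Rightarrow> 'c"
    and \<Delta> :: "'c \<Rightarrow> ('c, 'c, 'k) tensor"
    and \<psi>C \<omega>C :: "'c \<Rightarrow> 'c" +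
  fixes sM :: "'k \<Rightarrow> 'm::ab_group_add \<Rightarrow> 'm"
    and \<phi> :: "'m \<Rightarrow> ('m, 'c, 'k) tensor"
    and \<psi>M \<omega>M :: "'m \<Rightarrow> 'm"
  assumes comodule_vector_space: "vector_space sM"
    and coact_linear: "linear_to_tensor sM sM sC \<phi>"
    and psiM_linear: "Vector_Spaces.linear sM sM \<psi>M"
    and omegaM_linear: "Vector_Spaces.linear sM sM \<omega>M"
    and psiM_omegaM: "\<psi>M \<circ> \<omega>M = \<omega>M \<circ> \<psi>M"
    and psiM_coact: "tensor_map sM sC \<psi>M \<psi>C (\<phi> m) = \<phi> (\<psi>M m)"
    and omegaM_coact: "tensor_map sM sC \<omega>M \<omega>C (\<phi> m) = \<phi> (\<omega>M m)"
    and coact_coassoc: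
      "tensor_map_right sM sC sC \<omega>M \<Delta> (\<phi> m) = tensor_map_left sM sC sC \<phi> \<psi>C (\<phi> m)"

locale right_module =
  fixes sC :: "'k::field \<Rightarrow> 'c::ab_group_add \<Rightarrow> 'c"
    and \<mu> :: "'c \<Rightarrow> 'c \<Rightarrow> 'c"
    and \<alpha>C \<beta>C :: "'c \<Rightarrow> 'c"
    and sM :: "'k \<Rightarrow> 'm::ab_group_add \<Rightarrow> 'm"
    and \<nu> :: "'m \<Rightarrow> 'c \<Rightarrow> 'm"
    and \<alpha>M \<beta>M :: "'m \<Rightarrow> 'm"
  assumes module_vector_space: "vector_space sM"
    and act_bilinear: "bilinear_map sM sC sM \<nu>"
    and alphaM_linear: "Vector_Spaces.linear sM sM \<alpha>M"
    and betaM_linear: "Vector_Spaces.linear sM sM \<beta>M"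
    and alphaM_betaM: "\<alpha>M \<circ> \<beta>M = \<beta>M \<circ> \<alpha>M"
    and alphaM_act: "\<alpha>M (\<nu> m c) = \<nu> (\<alpha>M m) (\<alpha>C c)"
    and betaM_act: "\<beta>M (\<nu> m c) = \<nu> (\<beta>M m) (\<beta>C c)"
    and act_assoc: "\<nu> (\<alpha>M m) (\<mu> c d) = \<nu> (\<nu> m c) (\<beta>C d)"

locale right_infBH_Hopf_module =
  right_comodule sC \<Delta> \<psi>C \<omega>C sM \<phi> \<psi>M \<omega>M + right_module sC \<mu> \<alpha>C \<beta>C sM \<nu> \<alpha>M \<beta>M
  for l :: "'k::field"
    and sC :: "'k \<Rightarrow> 'c::ab_group_add \<Rightarrow> 'c"
    and \<mu> :: "'c \<Rightarrow> 'c \<Rightarrow> 'c"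
    and \<Delta> :: "'c \<Rightarrow> ('c, 'c, 'k) tensor"
    and \<alpha>C \<beta>C \<psi>C \<omega>C :: "'c \<Rightarrow> 'c"
    and sM :: "'k \<Rightarrow> 'm::ab_group_add \<Rightarrow> 'm"
    and \<nu> :: "'m \<Rightarrow> 'c \<Rightarrow> 'm"
    and \<phi> :: "'m \<Rightarrow> ('m, 'c, 'k) tensor"
    and \<alpha>M \<beta>M \<psi>M \<omega>M :: "'m \<Rightarrow> 'm" +
  assumes structure_maps_commute:
      "f \<in> {\<alpha>M, \<beta>M, \<psi>M, \<omega>M} \<Longrightarrow> g \<in> {\<alpha>M, \<beta>M, \<psi>M, \<omega>M} \<Longrightarrow> f \<circ> g = g \<circ> f"
    and coact_act:
      "\<phi> (\<nu> m c) =
        tensor_add sM sC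
          (tensor_add sM sC
            (tensor_map sM sC (\<lambda>c1. \<nu> (\<omega>M m) c1) \<beta>C (\<Delta> c))
            (tensor_map sM sC \<alpha>M (\<lambda>m1. \<mu> m1 (\<psi>C c)) (\<phi> m)))
          (tensor_scale sM sC l (pure_tensor sM sC (\<alpha>M (\<omega>M m)) (\<beta>C (\<psi>C c))))"

end

theory Submission
  imports Defs
begin

text \<open>Both sides of each axiom reduce to Sweedler sums of scalar- or \<open>M\<close>-valued multilinear maps;
  for the compatibility of the coaction with the action this uses that, over a field, bilinear
  forms separate the elements of a tensor product. By coassociativity,
  \<open>\<phi>(m \<triangleleft> c) = \<alpha>(m\<^sub>0) \<otimes> \<alpha>\<omega>\<^sup>-\<^sup>1(m\<^sub>1\<^sub>1) \<sigma>(m\<^sub>1\<^sub>2, \<psi>\<^sup>2(c)) - \<lambda> \<epsilon>(c) \<alpha>(m\<^sub>0) \<otimes> \<alpha>(m\<^sub>1)\<close>.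
  Its first term is the first term of \<open>\<alpha>(m\<^sub>0) \<otimes> m\<^sub>1 \<psi>(c)\<close>, and the remaining terms of the compatibility
  condition cancel in pairs. Applying \<open>\<sigma>(-, \<psi>\<beta>(d))\<close> to the same formula turns associativity of the
  action into the Yang-Baxter type axiom for \<open>\<sigma>\<close> at \<open>(m\<^sub>1, \<psi>(c), \<psi>(d))\<close>.\<close>

section \<open>Linear extension from free vector spaces, and separation by functionals\<close>

definition free_ext :: "('k::field \<Rightarrow> 'v::ab_group_add \<Rightarrow> 'v) \<Rightarrow> ('x \<Rightarrow> 'v) \<Rightarrow> ('x \<Rightarrow>\<^sub>0 'k) \<Rightarrow> 'v"
  where "free_ext sV F p = (\<Sum>x\<in>Poly_Mapping.keys p. sV (Poly_Mapping.lookup p x) (F x))"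

text \<open>Splits a Sweedler sum into the choice of a representative and a linear extension;
  independence of the choice then means that the extension vanishes on the null space.\<close>

lemma tensor_sum_eq_free_ext: "tensor_sum sV F X = free_ext sV (\<lambda>(a, b). F a b) (tensor_rep X)"
  by (simp add: tensor_sum_def free_ext_def Let_def case_prod_unfold)

lemma lookup_free_scale: "Poly_Mapping.lookup (free_scale k p) x = k * Poly_Mapping.lookup p x"
  by (simp add: free_scale_def map.rep_eq when_def)

lemma vector_space_free_scale: "vector_space free_scale"
  by standard (auto intro!: poly_mapping_eqI simp: lookup_free_scale lookup_add algebra_simps)

text \<open>Keys can cancel in a sum, so extensions are compared termwise only after all index sets
  are enlarged to a common finite one.\<close>

lemma free_ext_superset:
  assumes "vector_space sV" "finite A" "Poly_Mapping.keys p \<subseteq> A"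
  shows "free_ext sV F p = (\<Sum>x\<in>A. sV (Poly_Mapping.lookup p x) (F x))"
proof -
  interpret vector_space sV by fact
  show ?thesis unfolding free_ext_def
    using assms by (intro sum.mono_neutral_left) (auto simp: in_keys_iff)
qed

lemma linear_free_ext:
  assumes "vector_space sV"
  shows "Vector_Spaces.linear free_scale sV (free_ext sV F)"
proof -
  interpret vector_space sV by fact
  have add: "free_ext sV F (p + q) = free_ext sV F p + free_ext sV F q" for p q
  proof -
    let ?A = "Poly_Mapping.keys p \<union> Poly_Mapping.keys q"
    have "free_ext sV F r = (\<Sum>x\<in>?A. sV (Poly_Mapping.lookup r x) (F x))"
      if "r \<in> {p, q, p + q}" for r
      using that Poly_Mapping.keys_add[of p q]
      by (intro free_ext_superset) (auto simp: assms)
    then show ?thesis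
      by (simp add: lookup_add scale_left_distrib sum.distrib)
  qed
  have scale: "free_ext sV F (free_scale k p) = sV k (free_ext sV F p)" for k p
  proof -
    have "Poly_Mapping.keys (free_scale k p) \<subseteq> Poly_Mapping.keys p"
      by (auto simp: in_keys_iff lookup_free_scale)
    then have "free_ext sV F (free_scale k p)
      = (\<Sum>x\<in>Poly_Mapping.keys p. sV (k * Poly_Mapping.lookup p x) (F x))"
      by (subst free_ext_superset[OF assms finite_keys]) (auto simp: lookup_free_scale)
    then show ?thesis by (simp add: free_ext_def scale_sum_right)
  qed
  show ?thesis
    unfolding Vector_Spaces.linear_iff using assms vector_space_free_scale add scale by blast
qed

lemma free_ext_gen [simp]:
  assumes "vector_space sV"
  shows "free_ext sV F (gen x) = F x"
proof -
  interpret vector_space sV by fact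
  show ?thesis by (simp add: free_ext_def)
qed

text \<open>A finitely supported function is the combination of its own generators, so a linear map
  is determined by its values on them.\<close>

lemma linear_eq_free_ext:
  assumes "Vector_Spaces.linear free_scale sV f"
  shows "f p = free_ext sV (\<lambda>x. f (gen x)) p"
proof -
  interpret f: Vector_Spaces.linear free_scale sV f by fact
  have "p = free_ext free_scale gen p"
    by (rule poly_mapping_eqI)
      (simp add: free_ext_def lookup_sum lookup_free_scale lookup_single when_def in_keys_iff
        if_distrib[of "(*) _"] cong: if_cong)
  then have "f p = f (free_ext free_scale gen p)" by simp
  then show ?thesis by (simp add: free_ext_def f.sum f.scale)
qed

lemma linear_vanishes_on_span:
  assumes "Vector_Spaces.linear s1 s2 f" "\<And>x. x \<in> S \<Longrightarrow> f x = 0" "x \<in> module.span s1 S"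
  shows "f x = 0"
proof -
  interpret f: Vector_Spaces.linear s1 s2 f by fact
  show ?thesis using assms f.eq_0_on_span by blast
qed

lemma vector_space_mult: "vector_space ((*) :: 'k::field \<Rightarrow> 'k \<Rightarrow> 'k)"
  by standard (auto simp: algebra_simps)

text \<open>Thin \<open>S\<close> to an independent \<open>B\<close> with the same span. Then
  \<open>insert v B\<close> is independent, and the prescription 1 at \<open>v\<close>, 0 on
  \<open>B\<close> extends linearly.\<close>

lemma linear_functional_separates:
  fixes s :: "'k::field \<Rightarrow> 'v::ab_group_add \<Rightarrow> 'v"
  assumes "vector_space s" "v \<notin> module.span s S"
  shows "\<exists>f. Vector_Spaces.linear s (*) f \<and> (\<forall>x\<in>S. f x = 0) \<and> f v = 1"
proof -
  interpret vector_space s by fact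
  interpret k: vector_space "(*) :: 'k \<Rightarrow> 'k \<Rightarrow> 'k" by (rule vector_space_mult)
  interpret vector_space_pair s "(*) :: 'k \<Rightarrow> 'k \<Rightarrow> 'k" ..
  obtain B where B: "B \<subseteq> S" "independent B" "S \<subseteq> span B"
    by (rule maximal_independent_subset)
  have "v \<notin> span B"
    using assms(2) span_mono[OF B(1)] by blast
  then have "independent (insert v B)"
    using B(2) by (simp add: independent_insertI)
  then obtain f where f: "Vector_Spaces.linear s (*) f"
    "\<And>x. x \<in> insert v B \<Longrightarrow> f x = (if x = v then 1 else 0)"
    using linear_independent_extend[of "insert v B" "\<lambda>x. if x = v then 1 else 0"] by blast
  have fB: "f x = 0" if "x \<in> B" for x
    using that f(2)[of x] \<open>v \<notin> span B\<close> span_base by force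
  have "f x = 0" if "x \<in> S" for x
    using linear_vanishes_on_span[OF f(1) fB] B(3) that by blast
  with f show ?thesis by auto
qed

section \<open>Multilinear maps and the universal property of the tensor product\<close>

lemma bilinear_mapI:
  assumes "vector_space sA" "vector_space sB" "vector_space sV"
    and "\<And>a a' b. F (a + a') b = F a b + F a' b" "\<And>a b b'. F a (b + b') = F a b + F a b'"
    and "\<And>k a b. F (sA k a) b = sV k (F a b)" "\<And>k a b. F a (sB k b) = sV k (F a b)"
  shows "bilinear_map sA sB sV F"
  using assms unfolding bilinear_map_def Vector_Spaces.linear_iff by blast

lemma bilinear_mapD:
  assumes "bilinear_map sA sB sV F"
  shows "vector_space sA" "vector_space sB" "vector_space sV"
    and "F (a + a') b = F a b + F a' b" "F a (b + b') = F a b + F a b'"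
    and "F (sA k a) b = sV k (F a b)" "F a (sB k b) = sV k (F a b)"
  using assms unfolding bilinear_map_def Vector_Spaces.linear_iff by blast+

text \<open>Bilinearity in the last two arguments and in the two outer ones together reaches every
  argument, so the facts about \<open>bilinear_map\<close> can be reused.\<close>

definition trilinear_map ::
  "('k::field \<Rightarrow> 'a::ab_group_add \<Rightarrow> 'a) \<Rightarrow> ('k \<Rightarrow> 'b::ab_group_add \<Rightarrow> 'b)
    \<Rightarrow> ('k \<Rightarrow> 'c::ab_group_add \<Rightarrow> 'c) \<Rightarrow> ('k \<Rightarrow> 'v::ab_group_add \<Rightarrow> 'v)
    \<Rightarrow> ('a \<Rightarrow> 'b \<Rightarrow> 'c \<Rightarrow> 'v) \<Rightarrow> bool"
  where "trilinear_map sA sB sC sV F \<longleftrightarrow>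
    (\<forall>a. bilinear_map sB sC sV (F a)) \<and> (\<forall>b. bilinear_map sA sC sV (\<lambda>a. F a b))"

text \<open>Bilinearity makes the extension send each defining relation to 0, and linearity carries
  this to their span.\<close>

lemma free_ext_tensor_null:
  assumes F: "bilinear_map sA sB sV F" and p: "p \<in> tensor_null sA sB"
  shows "free_ext sV (\<lambda>(a, b). F a b) p = 0"
proof -
  note V = bilinear_mapD(3)[OF F]
  interpret Vector_Spaces.linear free_scale sV "free_ext sV (\<lambda>(a, b). F a b)"
    by (rule linear_free_ext[OF V])
  show ?thesis
    by (rule linear_vanishes_on_span[OF linear_free_ext[OF V] _ p[unfolded tensor_null_def]])
      (auto simp: diff scale V bilinear_mapD(4-)[OF F])
qed

lemma free_ext_tensor_null3:
  assumes F: "trilinear_map sA sB sC sV F" and p: "p \<in> tensor_null3 sA sB sC"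
  shows "free_ext sV (\<lambda>(a, b, c). F a b c) p = 0"
proof -
  have F1: "bilinear_map sB sC sV (F a)" and F2: "bilinear_map sA sC sV (\<lambda>a. F a b)" for a b
    using F by (auto simp: trilinear_map_def)
  note V = bilinear_mapD(3)[OF F1]
  interpret Vector_Spaces.linear free_scale sV "free_ext sV (\<lambda>(a, b, c). F a b c)"
    by (rule linear_free_ext[OF V])
  show ?thesis
    by (rule linear_vanishes_on_span[OF linear_free_ext[OF V] _ p[unfolded tensor_null3_def]])
      (auto simp: diff scale V bilinear_mapD(4-)[OF F1] bilinear_mapD(4-)[OF F2])
qed

lemma zero_in_tensor_null: "0 \<in> tensor_null sA sB" "0 \<in> tensor_null3 sA sB sC"
proof -
  interpret vector_space free_scale by (rule vector_space_free_scale)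
  show "0 \<in> tensor_null sA sB" unfolding tensor_null_def by (rule span_zero)
next
  interpret vector_space free_scale by (rule vector_space_free_scale)
  show "0 \<in> tensor_null3 sA sB sC" unfolding tensor_null3_def by (rule span_zero)
qed

lemma tensor_rep_class:
  "tensor_rep (tensor_class sA sB p) - p \<in> tensor_null sA sB"
proof -
  have "p \<in> tensor_class sA sB p"
    by (simp add: tensor_class_def zero_in_tensor_null)
  then have "tensor_rep (tensor_class sA sB p) \<in> tensor_class sA sB p"
    unfolding tensor_rep_def by (rule someI)
  then show ?thesis by (simp add: tensor_class_def)
qed

lemma tensor_class_eqI:
  assumes "p - q \<in> tensor_null sA sB"
  shows "tensor_class sA sB p = tensor_class sA sB q"
proof -
  interpret vector_space free_scale by (rule vector_space_free_scale)
  show ?thesis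
  proof (intro set_eqI)
    fix r
    have "r - p \<in> tensor_null sA sB \<longleftrightarrow> (r - p) + (p - q) \<in> tensor_null sA sB"
      using assms span_add_eq2 unfolding tensor_null_def by blast
    then show "r \<in> tensor_class sA sB p \<longleftrightarrow> r \<in> tensor_class sA sB q"
      by (simp add: tensor_class_def)
  qed
qed

lemma tensor_class_rep:
  assumes "X \<in> tensor_space sA sB"
  shows "tensor_class sA sB (tensor_rep X) = X"
  using assms tensor_rep_class tensor_class_eqI unfolding tensor_space_def by fast

text \<open>Two representatives of a class differ by an element of the null space, on which the
  extension of \<open>F\<close> vanishes.\<close>

lemma tensor_sum_class:
  assumes F: "bilinear_map sA sB sV F"
  shows "tensor_sum sV F (tensor_class sA sB p) = free_ext sV (\<lambda>(a, b). F a b) p"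
proof -
  interpret Vector_Spaces.linear free_scale sV "free_ext sV (\<lambda>(a, b). F a b)"
    by (rule linear_free_ext[OF bilinear_mapD(3)[OF F]])
  show ?thesis
    using free_ext_tensor_null[OF F tensor_rep_class[of sA sB p]]
    by (simp add: tensor_sum_eq_free_ext diff)
qed

text \<open>If the representatives were inequivalent, some functional would vanish on all tensor
  relations and be 1 on their difference; restricted to generators it is a bilinear form telling
  \<open>X\<close> and \<open>Y\<close> apart.\<close>

lemma tensor_eqI:
  fixes sA :: "'k::field \<Rightarrow> 'a::ab_group_add \<Rightarrow> 'a" and sB :: "'k \<Rightarrow> 'b::ab_group_add \<Rightarrow> 'b"
  assumes sA: "vector_space sA" and sB: "vector_space sB"
    and X: "X \<in> tensor_space sA sB" and Y: "Y \<in> tensor_space sA sB"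
    and eq: "\<And>F. bilinear_map sA sB (*) F \<Longrightarrow> tensor_sum (*) F X = tensor_sum (*) F Y"
  shows "X = Y"
proof -
  let ?p = "tensor_rep X" and ?q = "tensor_rep Y"
  have "?p - ?q \<in> tensor_null sA sB"
  proof (rule ccontr)
    let ?R = "{gen (a + a', b) - gen (a, b) - gen (a', b) | a a' b. True}
     \<union> {gen (a, b + b') - gen (a, b) - gen (a, b') | a b b'. True}
     \<union> {gen (sA k a, b) - free_scale k (gen (a, b)) | k a b. True}
     \<union> {gen (a, sB k b) - free_scale k (gen (a, b)) | k a b. True}"
    assume "?p - ?q \<notin> tensor_null sA sB"
    then obtain f where f: "Vector_Spaces.linear free_scale (*) f"
      "\<forall>x\<in>?R. f x = 0" "f (?p - ?q) = 1"
      unfolding tensor_null_def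
      using linear_functional_separates[OF vector_space_free_scale] by blast
    interpret f: Vector_Spaces.linear free_scale "(*)" f by fact
    \<comment> \<open>Each family of relations annihilated by \<open>f\<close> is one clause of the
      bilinearity of \<open>F\<close>.\<close>
    define F where "F a b = f (gen (a, b))" for a b
    have F: "bilinear_map sA sB (*) F"
    proof (rule bilinear_mapI)
      show "F (a + a') b = F a b + F a' b" for a a' b
      proof -
        have "f (gen (a + a', b) - gen (a, b) - gen (a', b)) = 0"
          by (rule bspec[OF f(2)]) blast
        then show ?thesis
          by (simp add: F_def f.add f.diff f.scale diff_diff_eq)
      qed
      show "F a (b + b') = F a b + F a b'" for a b b'
      proof -
        have "f (gen (a, b + b') - gen (a, b) - gen (a, b')) = 0"
          by (rule bspec[OF f(2)]) blast
        then show ?thesis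
          by (simp add: F_def f.add f.diff f.scale diff_diff_eq)
      qed
      show "F (sA k a) b = k * F a b" for k a b
      proof -
        have "f (gen (sA k a, b) - free_scale k (gen (a, b))) = 0"
          by (rule bspec[OF f(2)]) blast
        then show ?thesis
          by (simp add: F_def f.add f.diff f.scale diff_diff_eq)
      qed
      show "F a (sB k b) = k * F a b" for k a b
      proof -
        have "f (gen (a, sB k b) - free_scale k (gen (a, b))) = 0"
          by (rule bspec[OF f(2)]) blast
        then show ?thesis
          by (simp add: F_def f.add f.diff f.scale diff_diff_eq)
      qed
    qed (fact sA sB vector_space_mult)+
    have f_eq: "f p = free_ext (*) (\<lambda>(a, b). F a b) p" for p
      using linear_eq_free_ext[OF f(1), of p] by (simp add: F_def case_prod_unfold)
    show False
      using eq[OF F] f(3) unfolding f.diff by (simp add: f_eq tensor_sum_eq_free_ext)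
  qed
  then show ?thesis
    using tensor_class_eqI tensor_class_rep X Y by metis
qed


section \<open>Calculus of Sweedler sums\<close>

lemma linear_tensor_sum:
  assumes "Vector_Spaces.linear sV sW h"
  shows "h (tensor_sum sV F X) = tensor_sum sW (\<lambda>a b. h (F a b)) X"
proof -
  interpret Vector_Spaces.linear sV sW h by fact
  show ?thesis by (simp add: tensor_sum_def Let_def case_prod_unfold sum scale)
qed

lemma tensor_sum_algebra:
  assumes "vector_space sV"
  shows tensor_sum_add: "tensor_sum sV (\<lambda>a b. F a b + G a b) X = tensor_sum sV F X + tensor_sum sV G X"
    and tensor_sum_diff: "tensor_sum sV (\<lambda>a b. F a b - G a b) X = tensor_sum sV F X - tensor_sum sV G X"
    and tensor_sum_scale: "tensor_sum sV (\<lambda>a b. sV k (F a b)) X = sV k (tensor_sum sV F X)"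
    and tensor_sum_scale_left: "tensor_sum sV (\<lambda>a b. sV (f a b) v) X = sV (tensor_sum (*) f X) v"
proof -
  interpret vector_space sV by fact
  show "tensor_sum sV (\<lambda>a b. F a b + G a b) X = tensor_sum sV F X + tensor_sum sV G X"
    and "tensor_sum sV (\<lambda>a b. F a b - G a b) X = tensor_sum sV F X - tensor_sum sV G X"
    and "tensor_sum sV (\<lambda>a b. sV k (F a b)) X = sV k (tensor_sum sV F X)"
    and "tensor_sum sV (\<lambda>a b. sV (f a b) v) X = sV (tensor_sum (*) f X) v"
    by (simp_all add: tensor_sum_def Let_def case_prod_unfold sum.distrib sum_subtractf
        scale_right_distrib scale_right_diff_distrib scale_sum_right scale_sum_left mult.commute)
qed

text \<open>The representatives of \<open>X\<close> and \<open>Y\<close> are chosen independently of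
  each other, so this is an exchange of two finite sums.\<close>

lemma tensor_sum_swap:
  assumes "vector_space sV"
  shows "tensor_sum sV (\<lambda>a b. tensor_sum sV (\<lambda>x y. F a b x y) Y) X
    = tensor_sum sV (\<lambda>x y. tensor_sum sV (\<lambda>a b. F a b x y) X) Y"
proof -
  interpret vector_space sV by fact
  show ?thesis
    unfolding tensor_sum_def Let_def case_prod_unfold scale_sum_right
    by (subst sum.swap) (simp add: mult.commute)
qed

text \<open>\<open>tensor_map\<close> is the class of an explicit free element; the universal
  property evaluates \<open>F\<close> there, and the linear extension passes through the inner
  sum.\<close>

lemma tensor_sum_tensor_map:
  assumes F: "bilinear_map sA sB sV F"
  shows "tensor_sum sV F (tensor_map sA sB f g X) = tensor_sum sV (\<lambda>x y. F (f x) (g y)) X"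
  unfolding tensor_map_def
  by (simp add: tensor_sum_class[OF F] bilinear_mapD(3)[OF F]
      linear_tensor_sum[OF linear_free_ext[OF bilinear_mapD(3)[OF F]]])

lemma tensor_sum_tensor_add:
  assumes F: "bilinear_map sA sB sV F"
  shows "tensor_sum sV F (tensor_add sA sB X Y) = tensor_sum sV F X + tensor_sum sV F Y"
proof -
  interpret Vector_Spaces.linear free_scale sV "free_ext sV (\<lambda>(a, b). F a b)"
    by (rule linear_free_ext[OF bilinear_mapD(3)[OF F]])
  show ?thesis
    unfolding tensor_add_def tensor_sum_class[OF F] add by (simp add: tensor_sum_eq_free_ext)
qed

lemma tensor_sum_tensor_scale:
  assumes F: "bilinear_map sA sB sV F"
  shows "tensor_sum sV F (tensor_scale sA sB k X) = sV k (tensor_sum sV F X)"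
proof -
  interpret Vector_Spaces.linear free_scale sV "free_ext sV (\<lambda>(a, b). F a b)"
    by (rule linear_free_ext[OF bilinear_mapD(3)[OF F]])
  show ?thesis
    unfolding tensor_scale_def tensor_sum_class[OF F] scale by (simp add: tensor_sum_eq_free_ext)
qed

lemma tensor_sum_pure_tensor:
  assumes F: "bilinear_map sA sB sV F"
  shows "tensor_sum sV F (pure_tensor sA sB a b) = F a b"
  by (simp add: pure_tensor_def tensor_sum_class[OF F] bilinear_mapD(3)[OF F])

lemma linear_tensor_sum_linear_to_tensor:
  assumes "linear_to_tensor sX sA sB h" "vector_space sX" and F: "bilinear_map sA sB sV F"
  shows "Vector_Spaces.linear sX sV (\<lambda>x. tensor_sum sV F (h x))"
  using assms bilinear_mapD(3)[OF F]
  by (simp add: Vector_Spaces.linear_iff linear_to_tensor_def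
      tensor_sum_tensor_add[OF F] tensor_sum_tensor_scale[OF F])

text \<open>Equal cosets have representatives differing by a null element, which the extension of
  \<open>F\<close> kills. In this form coassociativity can be applied to Sweedler sums.\<close>

lemma tensor_map_left_eq_right:
  assumes F: "trilinear_map sA sB sC sV F"
    and eq: "tensor_map_left sA sB sC h g X = tensor_map_right sA sB sC f k Y"
  shows "tensor_sum sV (\<lambda>x y. tensor_sum sV (\<lambda>a b. F a b (g y)) (h x)) X
    = tensor_sum sV (\<lambda>x y. tensor_sum sV (\<lambda>b c. F (f x) b c) (k y)) Y"
proof -
  let ?e = "free_ext sV (\<lambda>(a, b, c). F a b c)"
  let ?p = "tensor_sum free_scale
        (\<lambda>x y. tensor_sum free_scale (\<lambda>a b. gen (a, b, g y)) (h x)) X"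
  let ?q = "tensor_sum free_scale
        (\<lambda>x y. tensor_sum free_scale (\<lambda>b c. gen (f x, b, c)) (k y)) Y"
  have V: "vector_space sV"
    using F unfolding trilinear_map_def by (auto dest: bilinear_mapD(3))
  interpret Vector_Spaces.linear free_scale sV ?e
    by (rule linear_free_ext[OF V])
  have "?p \<in> tensor_class3 sA sB sC ?p"
    by (simp add: tensor_class3_def zero_in_tensor_null)
  then have "?p \<in> tensor_class3 sA sB sC ?q"
    using eq unfolding tensor_map_left_def tensor_map_right_def by blast
  then have "?p - ?q \<in> tensor_null3 sA sB sC"
    by (simp add: tensor_class3_def)
  then have "?e (?p - ?q) = 0"
    by (rule free_ext_tensor_null3[OF F])
  then have "?e ?p = ?e ?q"
    unfolding diff by simp
  then show ?thesis
    by (simp add: linear_tensor_sum[OF linear_free_ext[OF V]] V)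
qed

lemma trilinear_mapI:
  assumes "vector_space sA" "vector_space sB" "vector_space sC" "vector_space sV"
    and "\<And>a a' b c. F (a + a') b c = F a b c + F a' b c"
    and "\<And>a b b' c. F a (b + b') c = F a b c + F a b' c"
    and "\<And>a b c c'. F a b (c + c') = F a b c + F a b c'"
    and "\<And>k a b c. F (sA k a) b c = sV k (F a b c)"
    and "\<And>k a b c. F a (sB k b) c = sV k (F a b c)"
    and "\<And>k a b c. F a b (sC k c) = sV k (F a b c)"
  shows "trilinear_map sA sB sC sV F"
  unfolding trilinear_map_def by (intro allI conjI bilinear_mapI assms)

lemma linear_inv:
  assumes "Vector_Spaces.linear s s f" "bij f"
  shows "Vector_Spaces.linear s s (inv f)"
proof -
  interpret f: Vector_Spaces.linear s s f by fact
  have inv: "f (inv f x) = x" "inv f (f x) = x" for x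
    using assms(2) by (simp_all add: bij_is_inj bij_is_surj surj_f_inv_f)
  have "inv f (x + y) = inv f x + inv f y" for x y
    using inv(2)[of "inv f x + inv f y"] by (simp add: f.add inv(1))
  moreover have "inv f (s k x) = s k (inv f x)" for k x
    using inv(2)[of "s k (inv f x)"] by (simp add: f.scale inv(1))
  ultimately show ?thesis
    by (simp add: Vector_Spaces.linear_iff f.vs1.vector_space_axioms)
qed

lemma linearD:
  assumes "Vector_Spaces.linear s1 s2 f"
  shows "f (x + y) = f x + f y" "f (s1 k x) = s2 k (f x)"
  using assms unfolding Vector_Spaces.linear_iff by blast+

text \<open>Products are tested below by three kinds of \<open>h\<close>: the counit, a slice of a
  bilinear form, and \<open>\<sigma>\<close> with its first argument fixed.\<close>

lemma linear_mu_sigma: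
  assumes h: "Vector_Spaces.linear s sV h"
  shows "h (mu_sigma l s \<Delta> \<epsilon> \<alpha> \<beta> \<psi> \<omega> \<sigma> c d) =
    tensor_sum sV (\<lambda>c1 c2. sV (\<sigma> c2 (\<psi> d)) (h (\<alpha> (inv \<omega> c1)))) (\<Delta> c)
    - tensor_sum sV (\<lambda>d1 d2. sV (\<sigma> (\<omega> c) d1) (h (\<beta> (inv \<psi> d2)))) (\<Delta> d)
    - sV (l * \<epsilon> d) (h (\<alpha> c))"
proof -
  interpret Vector_Spaces.linear s sV h by fact
  show ?thesis
    by (simp add: mu_sigma_def diff scale linear_tensor_sum[OF h])
qed

section \<open>The coaction, and its value on the action\<close>

locale coquasitriangular_coaction =
  coquasitriangular_infBH_bialgebra l sC \<Delta> \<epsilon> \<alpha>C \<beta>C \<psi>C \<omega>C \<sigma> +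
  right_comodule sC \<Delta> \<psi>C \<omega>C sM \<phi> \<psi>M \<omega>M
  for l :: "'k::field"
    and sC :: "'k \<Rightarrow> 'c::ab_group_add \<Rightarrow> 'c"
    and \<Delta> :: "'c \<Rightarrow> ('c, 'c, 'k) tensor"
    and \<epsilon> :: "'c \<Rightarrow> 'k"
    and \<alpha>C \<beta>C \<psi>C \<omega>C :: "'c \<Rightarrow> 'c"
    and \<sigma> :: "'c \<Rightarrow> 'c \<Rightarrow> 'k"
    and sM :: "'k \<Rightarrow> 'm::ab_group_add \<Rightarrow> 'm"
    and \<phi> :: "'m \<Rightarrow> ('m, 'c, 'k) tensor"
    and \<psi>M \<omega>M :: "'m \<Rightarrow> 'm" +
  fixes \<alpha>M :: "'m \<Rightarrow> 'm" and \<nu> :: "'m \<Rightarrow> 'c \<Rightarrow> 'm"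
  assumes omegaM_bij: "bij \<omega>M"
    and alphaM_linear: "Vector_Spaces.linear sM sM \<alpha>M"
    and alphaM_omegaM: "\<alpha>M \<circ> \<omega>M = \<omega>M \<circ> \<alpha>M"
    and alphaM_coact: "\<phi> (\<alpha>M m) = tensor_map sM sC \<alpha>M \<alpha>C (\<phi> m)"
    and act_def: "\<nu> m c =
      tensor_sum sM (\<lambda>m0 m1. sM (\<sigma> m1 (\<psi>C c)) (\<alpha>M (inv \<omega>M m0))) (\<phi> m) - sM (l * \<epsilon> c) (\<alpha>M m)"
begin

interpretation C: vector_space sC by (rule vector_space)
interpretation M: vector_space sM by (rule comodule_vector_space)

abbreviation "mult \<equiv> mu_sigma l sC \<Delta> \<epsilon> \<alpha>C \<beta>C \<psi>C \<omega>C \<sigma>"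

lemmas inv_linear = linear_inv[OF psi_linear psi_bij] linear_inv[OF omega_linear omega_bij]
  linear_inv[OF omegaM_linear omegaM_bij]

lemmas map_simps = bilinear_mapD(4-)[OF sigma_bilinear] linearD[OF counit_linear]
  linearD[OF psi_linear] linearD[OF omega_linear] linearD[OF alpha_linear] linearD[OF beta_linear]
  linearD[OF omegaM_linear] linearD[OF alphaM_linear]
  linearD[OF inv_linear(1)] linearD[OF inv_linear(2)] linearD[OF inv_linear(3)]

lemma inv_simps [simp]:
  "inv \<psi>C (\<psi>C c) = c" "\<psi>C (inv \<psi>C c) = c" "inv \<omega>C (\<omega>C c) = c" "\<omega>C (inv \<omega>C c) = c"
  "inv \<omega>M (\<omega>M m) = m" "\<omega>M (inv \<omega>M m) = m"
  using psi_bij omega_bij omegaM_bij by (simp_all add: bij_is_inj bij_is_surj surj_f_inv_f)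

lemma sigma_simps [simp]:
  "\<sigma> (\<alpha>C c) (\<alpha>C d) = \<sigma> c d" "\<sigma> (\<beta>C c) (\<beta>C d) = \<sigma> c d"
  "\<sigma> (\<psi>C c) (\<psi>C d) = \<sigma> c d" "\<sigma> (\<omega>C c) (\<omega>C d) = \<sigma> c d"
  by (simp_all add: sigma_invariant)

text \<open>Oriented so that \<open>\<psi>C\<close> ends outermost, then \<open>\<omega>C\<close>,
  with \<open>\<alpha>C\<close> and \<open>\<beta>C\<close> inside; \<open>sigma_simps\<close> can
  then strip common outer maps.\<close>

lemma commute_simps:
  "\<alpha>C (\<psi>C c) = \<psi>C (\<alpha>C c)" "\<alpha>C (\<omega>C c) = \<omega>C (\<alpha>C c)" "\<beta>C (\<psi>C c) = \<psi>C (\<beta>C c)"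
  "\<beta>C (\<omega>C c) = \<omega>C (\<beta>C c)" "\<omega>C (\<psi>C c) = \<psi>C (\<omega>C c)" "\<alpha>M (\<omega>M m) = \<omega>M (\<alpha>M m)"
  using alpha_psi alpha_omega beta_psi beta_omega psi_omega alphaM_omegaM
  by (simp_all add: fun_eq_iff)

lemma commute_inv_simps:
  "\<alpha>C (inv \<omega>C c) = inv \<omega>C (\<alpha>C c)" "\<beta>C (inv \<psi>C c) = inv \<psi>C (\<beta>C c)"
  "\<psi>C (inv \<omega>C c) = inv \<omega>C (\<psi>C c)" "\<alpha>M (inv \<omega>M m) = inv \<omega>M (\<alpha>M m)"
  using commute_simps(2)[of "inv \<omega>C c"] commute_simps(3)[of "inv \<psi>C c"]
    commute_simps(5)[of "inv \<omega>C c"] commute_simps(6)[of "inv \<omega>M m"]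
  by (metis inv_simps(3,4), metis inv_simps(1,2), metis inv_simps(3,4), metis inv_simps(5,6))

lemma tensor_sum_coact:
  assumes F: "bilinear_map sM sC sV F"
  shows "tensor_sum sV F (\<phi> (\<alpha>M m)) = tensor_sum sV (\<lambda>x y. F (\<alpha>M x) (\<alpha>C y)) (\<phi> m)"
    and "tensor_sum sV F (\<phi> (\<omega>M m)) = tensor_sum sV (\<lambda>x y. F (\<omega>M x) (\<omega>C y)) (\<phi> m)"
    and "tensor_sum sV F (\<phi> (inv \<omega>M m)) = tensor_sum sV (\<lambda>x y. F (inv \<omega>M x) (inv \<omega>C y)) (\<phi> m)"
proof -
  show "tensor_sum sV F (\<phi> (\<alpha>M m)) = tensor_sum sV (\<lambda>x y. F (\<alpha>M x) (\<alpha>C y)) (\<phi> m)"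
    by (simp add: alphaM_coact tensor_sum_tensor_map[OF F])
  have omega: "tensor_sum sV F (\<phi> (\<omega>M m)) = tensor_sum sV (\<lambda>x y. F (\<omega>M x) (\<omega>C y)) (\<phi> m)"
    if "bilinear_map sM sC sV F" for F m
    by (simp add: omegaM_coact[symmetric] tensor_sum_tensor_map[OF that])
  show "tensor_sum sV F (\<phi> (\<omega>M m)) = tensor_sum sV (\<lambda>x y. F (\<omega>M x) (\<omega>C y)) (\<phi> m)"
    by (rule omega[OF F])
  \<comment> \<open>For the inverse, the identity for \<open>\<omega>M\<close> is applied at
    \<open>inv \<omega>M m\<close> to the form twisted by the inverses, which then cancel inside the
    sum.\<close>
  have "bilinear_map sM sC sV (\<lambda>x y. F (inv \<omega>M x) (inv \<omega>C y))"
    using bilinear_mapD[OF F] by (intro bilinear_mapI) (simp_all add: map_simps)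
  from omega[OF this, of "inv \<omega>M m"]
  show "tensor_sum sV F (\<phi> (inv \<omega>M m)) = tensor_sum sV (\<lambda>x y. F (inv \<omega>M x) (inv \<omega>C y)) (\<phi> m)"
    by simp
qed

lemma tensor_sum_comult:
  assumes F: "bilinear_map sC sC sV F"
  shows "tensor_sum sV F (\<Delta> (\<psi>C c)) = tensor_sum sV (\<lambda>x y. F (\<psi>C x) (\<psi>C y)) (\<Delta> c)"
  by (simp add: psi_comult[symmetric] tensor_sum_tensor_map[OF F])

lemma tensor_sum_coact_coassoc:
  assumes F: "trilinear_map sM sC sC sV F"
  shows "tensor_sum sV (\<lambda>m0 m1. tensor_sum sV (\<lambda>a b. F a b (\<psi>C m1)) (\<phi> m0)) (\<phi> m)
    = tensor_sum sV (\<lambda>m0 m1. tensor_sum sV (\<lambda>a b. F (\<omega>M m0) a b) (\<Delta> m1)) (\<phi> m)"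
  by (rule tensor_map_left_eq_right[OF F coact_coassoc[symmetric]])

lemma linear_tensor_sum_act:
  assumes "Vector_Spaces.linear sM sV h"
  shows "h (\<nu> m c) = tensor_sum sV (\<lambda>m0 m1. sV (\<sigma> m1 (\<psi>C c)) (h (\<alpha>M (inv \<omega>M m0)))) (\<phi> m)
    - sV (l * \<epsilon> c) (h (\<alpha>M m))"
proof -
  interpret Vector_Spaces.linear sM sV h by fact
  show ?thesis
    unfolding act_def diff scale linear_tensor_sum[OF assms] ..
qed

text \<open>The coaction is carried through the action by linearity and through
  \<open>\<alpha>M\<close> and \<open>inv \<omega>M\<close> by colinearity; coassociativity then
  trades the coaction on \<open>m0\<close> for a coproduct of \<open>m1\<close>.\<close>

lemma tensor_sum_coact_act:
  assumes F: "bilinear_map sM sC sV F"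
  shows "tensor_sum sV F (\<phi> (\<nu> m c)) =
    tensor_sum sV (\<lambda>m0 m1. tensor_sum sV
      (\<lambda>a b. sV (\<sigma> b (\<psi>C (\<psi>C c))) (F (\<alpha>M m0) (\<alpha>C (inv \<omega>C a)))) (\<Delta> m1)) (\<phi> m)
    - sV (l * \<epsilon> c) (tensor_sum sV (\<lambda>m0 m1. F (\<alpha>M m0) (\<alpha>C m1)) (\<phi> m))"
proof -
  note V = bilinear_mapD(3)[OF F]
  interpret V: vector_space sV by (rule V)
  \<comment> \<open>With \<open>z\<close> equal to \<open>\<psi>C m1\<close>, invariance of \<sigma>
    under \<psi> strips one \<open>\<psi>C\<close> from each argument and returns the original
    coefficient; with \<open>x\<close> equal to \<open>\<omega>M m0\<close>, the inverse of
    \<open>\<omega>M\<close> disappears.\<close>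
  let ?G = "\<lambda>x y z. sV (\<sigma> z (\<psi>C (\<psi>C c))) (F (\<alpha>M (inv \<omega>M x)) (\<alpha>C (inv \<omega>C y)))"
  have F': "bilinear_map sM sC sV (\<lambda>x y. F (\<alpha>M x) (\<alpha>C y))"
    by (intro bilinear_mapI)
      (simp_all add: map_simps bilinear_mapD(4-)[OF F] V C.vector_space_axioms M.vector_space_axioms)
  have G: "trilinear_map sM sC sC sV ?G"
    by (intro trilinear_mapI)
      (simp_all add: map_simps bilinear_mapD(4-)[OF F] V C.vector_space_axioms M.vector_space_axioms
        V.scale_left_distrib V.scale_right_distrib mult.commute)
  have "tensor_sum sV F (\<phi> (\<nu> m c)) =
      tensor_sum sV (\<lambda>m0 m1. sV (\<sigma> m1 (\<psi>C c)) (tensor_sum sV F (\<phi> (\<alpha>M (inv \<omega>M m0))))) (\<phi> m)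
      - sV (l * \<epsilon> c) (tensor_sum sV F (\<phi> (\<alpha>M m)))"
    by (rule linear_tensor_sum_act
        [OF linear_tensor_sum_linear_to_tensor[OF coact_linear comodule_vector_space F]])
  also have "\<dots> = tensor_sum sV (\<lambda>m0 m1. tensor_sum sV (\<lambda>a b. ?G a b (\<psi>C m1)) (\<phi> m0)) (\<phi> m)
      - sV (l * \<epsilon> c) (tensor_sum sV (\<lambda>m0 m1. F (\<alpha>M m0) (\<alpha>C m1)) (\<phi> m))"
    by (simp add: tensor_sum_coact(1)[OF F] tensor_sum_coact(3)[OF F'] tensor_sum_scale[OF V])
  also have "\<dots> = tensor_sum sV (\<lambda>m0 m1. tensor_sum sV (\<lambda>a b. ?G (\<omega>M m0) a b) (\<Delta> m1)) (\<phi> m)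
      - sV (l * \<epsilon> c) (tensor_sum sV (\<lambda>m0 m1. F (\<alpha>M m0) (\<alpha>C m1)) (\<phi> m))"
    by (simp only: tensor_sum_coact_coassoc[OF G])
  finally show ?thesis by simp
qed

section \<open>The form \<sigma> and the counit on products\<close>

lemma sigma_mult:
  "\<sigma> (\<alpha>C x) (\<psi>C (mult c d)) =
    tensor_sum (*) (\<lambda>a b. \<sigma> (\<omega>C x) (\<psi>C a) * \<sigma> b (\<psi>C d)) (\<Delta> c)
    - tensor_sum (*) (\<lambda>a b. \<sigma> (\<omega>C c) a * \<sigma> (\<alpha>C x) (\<beta>C b)) (\<Delta> d)
    - l * \<epsilon> d * \<sigma> x (\<psi>C c)"
proof -
  have lin: "Vector_Spaces.linear sC (*) (\<lambda>y. \<sigma> (\<alpha>C x) (\<psi>C y))"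
    by (simp add: Vector_Spaces.linear_iff map_simps C.vector_space_axioms vector_space_mult)
  \<comment> \<open>Invariance under \<alpha> removes \<open>\<alpha>C\<close> from both arguments;
    invariance under \<omega> then trades its inverse on the right for \<open>\<omega>C\<close> on
    the left.\<close>
  have "\<sigma> (\<alpha>C x) (\<psi>C (\<alpha>C (inv \<omega>C a))) = \<sigma> (\<omega>C x) (\<psi>C a)" for a
    using sigma_simps(1)[of x "\<psi>C (inv \<omega>C a)"] sigma_simps(4)[of x "inv \<omega>C (\<psi>C a)"]
    by (simp add: commute_simps commute_inv_simps)
  moreover have "\<sigma> (\<alpha>C x) (\<psi>C (\<alpha>C c)) = \<sigma> x (\<psi>C c)"
    using sigma_simps(1)[of x "\<psi>C c"] by (simp add: commute_simps)
  ultimately show ?thesis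
    unfolding linear_mu_sigma[OF lin] by (simp add: commute_inv_simps(2) mult.commute)
qed

text \<open>The left side is the inner sum met when acting twice. The axiom at \<open>x\<close>,
  \<open>\<psi>C c\<close>, \<open>\<psi>C d\<close> rewrites it by two sums that
  \<open>sigma_mult\<close> recognises as part of a product; the first \<lambda>-term makes up for
  the one in \<open>sigma_mult\<close>, the second is the right side of the axiom.\<close>

lemma yang_baxter_mult:
  "tensor_sum (*) (\<lambda>a b. \<sigma> (\<alpha>C a) (\<beta>C (\<omega>C (\<psi>C d))) * \<sigma> b (\<psi>C (\<psi>C c))) (\<Delta> x)
    = \<sigma> (\<alpha>C x) (\<psi>C (mult c d)) + l * \<epsilon> d * \<sigma> x (\<psi>C c) + l * \<epsilon> c * \<sigma> (\<alpha>C x) (\<psi>C (\<beta>C d))"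
proof -
  have 1: "bilinear_map sC sC (*) (\<lambda>a b. \<sigma> (\<omega>C x) a * \<sigma> b (\<psi>C (\<psi>C d)))"
    and 2: "bilinear_map sC sC (*) (\<lambda>a b. \<sigma> (\<omega>C (\<psi>C c)) a * \<sigma> (\<alpha>C (\<psi>C x)) (\<beta>C b))"
    by (intro bilinear_mapI vector_space vector_space_mult;
        simp add: map_simps distrib_left distrib_right)+
  have sigma: "\<sigma> (\<omega>C (\<psi>C c)) (\<psi>C a) = \<sigma> (\<omega>C c) a"
    "\<sigma> (\<alpha>C (\<psi>C x)) (\<beta>C (\<psi>C b)) = \<sigma> (\<alpha>C x) (\<beta>C b)" for a b
    by (simp_all add: commute_simps)
  have "tensor_sum (*) (\<lambda>a b. \<sigma> (\<alpha>C a) (\<beta>C (\<omega>C (\<psi>C d))) * \<sigma> b (\<psi>C (\<psi>C c))) (\<Delta> x)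
      - tensor_sum (*) (\<lambda>a b. \<sigma> (\<omega>C x) (\<psi>C a) * \<sigma> b (\<psi>C d)) (\<Delta> c)
      + tensor_sum (*) (\<lambda>a b. \<sigma> (\<omega>C c) a * \<sigma> (\<alpha>C x) (\<beta>C b)) (\<Delta> d)
      = l * \<sigma> (\<alpha>C x) (\<psi>C (\<beta>C d)) * \<epsilon> c"
    using sigma_yang_baxter[where c = x and d = "\<psi>C c" and e = "\<psi>C d"]
    unfolding tensor_sum_comult[OF 1] tensor_sum_comult[OF 2] sigma counit_psi
    by (simp only: sigma_simps commute_simps(3))
  then have yb: "tensor_sum (*) (\<lambda>a b. \<sigma> (\<alpha>C a) (\<beta>C (\<omega>C (\<psi>C d))) * \<sigma> b (\<psi>C (\<psi>C c))) (\<Delta> x)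
      = l * \<sigma> (\<alpha>C x) (\<psi>C (\<beta>C d)) * \<epsilon> c
      + tensor_sum (*) (\<lambda>a b. \<sigma> (\<omega>C x) (\<psi>C a) * \<sigma> b (\<psi>C d)) (\<Delta> c)
      - tensor_sum (*) (\<lambda>a b. \<sigma> (\<omega>C c) a * \<sigma> (\<alpha>C x) (\<beta>C b)) (\<Delta> d)"
    by (simp only: eq_diff_eq diff_add_eq diff_eq_eq)
  show ?thesis
    unfolding sigma_mult yb by simp
qed

text \<open>By the two counit axioms and invariance, both sums in the product collapse to
  \<sigma>(c, d) and cancel, leaving the \<lambda>-term.\<close>

lemma counit_mult: "\<epsilon> (mult c d) = - (l * \<epsilon> c * \<epsilon> d)"
proof -
  have lin1: "Vector_Spaces.linear sC (*) (\<lambda>y. \<sigma> y (\<psi>C d))"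
    and lin2: "Vector_Spaces.linear sC (*) (\<sigma> (\<omega>C c))"
    by (simp_all add: Vector_Spaces.linear_iff map_simps C.vector_space_axioms vector_space_mult)
  have inv: "\<epsilon> (inv \<omega>C x) = \<epsilon> x" "\<epsilon> (inv \<psi>C x) = \<epsilon> x" for x
    using counit_omega[of "inv \<omega>C x"] counit_psi[of "inv \<psi>C x"] by (simp_all only: inv_simps)
  have "tensor_sum (*) (\<lambda>a b. \<sigma> b (\<psi>C d) * \<epsilon> a) (\<Delta> c) = \<sigma> c d"
    using linear_tensor_sum[OF lin1, of "\<lambda>x y. sC (\<epsilon> x) y" "\<Delta> c"]
    by (simp add: counit_left map_simps mult.commute)
  moreover have "tensor_sum (*) (\<lambda>a b. \<sigma> (\<omega>C c) a * \<epsilon> b) (\<Delta> d) = \<sigma> c d"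
    using linear_tensor_sum[OF lin2, of "\<lambda>x y. sC (\<epsilon> y) x" "\<Delta> d"]
    by (simp add: counit_right map_simps mult.commute)
  ultimately show ?thesis
    unfolding linear_mu_sigma[OF counit_linear] counit_alpha counit_beta inv
    by simp
qed

section \<open>The module axioms\<close>

lemma bilinear_act_summand:
  "bilinear_map sM sC sM (\<lambda>m0 m1. sM (\<sigma> m1 d) (\<alpha>M (inv \<omega>M m0)))"
  by (intro bilinear_mapI) (simp_all add: map_simps C.vector_space_axioms M.vector_space_axioms
      M.scale_left_distrib M.scale_right_distrib mult.commute)

lemma act_bilinear: "bilinear_map sM sC sM \<nu>"
proof (rule bilinear_mapI)
  note coact = linearD[OF linear_tensor_sum_linear_to_tensor
      [OF coact_linear comodule_vector_space bilinear_act_summand]]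
  show "\<nu> (m + m') c = \<nu> m c + \<nu> m' c" for m m' c
    unfolding act_def coact map_simps M.scale_right_distrib by simp
  show "\<nu> (sM k m) c = sM k (\<nu> m c)" for m c k
    unfolding act_def coact map_simps M.scale_right_diff_distrib M.scale_scale
    by (simp only: mult.commute[of k])
  show "\<nu> m (c + c') = \<nu> m c + \<nu> m c'" for m c c'
    unfolding act_def map_simps M.scale_left_distrib distrib_left
      tensor_sum_add[OF comodule_vector_space] by simp
  show "\<nu> m (sC k c) = sM k (\<nu> m c)" for m c k
    unfolding act_def map_simps M.scale_right_diff_distrib
      tensor_sum_scale[OF comodule_vector_space, symmetric] M.scale_scale
    by (simp add: mult.left_commute)
qed (fact comodule_vector_space vector_space)+

text \<open>Serves both \<open>\<alpha>M\<close> with \<open>\<alpha>C\<close> and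
  \<open>\<beta>M\<close> with \<open>\<beta>C\<close>: colinearity of \<open>f\<close> puts
  \<open>g\<close> on the first argument of \<sigma>, where invariance matches it with
  \<open>g\<close> on the second.\<close>

lemma map_act:
  assumes "Vector_Spaces.linear sM sM f" "\<And>x. f (\<alpha>M x) = \<alpha>M (f x)" "\<And>x. f (\<omega>M x) = \<omega>M (f x)"
    and "\<And>x. \<phi> (f x) = tensor_map sM sC f g (\<phi> x)"
    and "\<And>x. \<epsilon> (g x) = \<epsilon> x" "\<And>x. g (\<psi>C x) = \<psi>C (g x)" "\<And>x y. \<sigma> (g x) (g y) = \<sigma> x y"
  shows "f (\<nu> m c) = \<nu> (f m) (g c)"
proof -
  have "f (inv \<omega>M x) = inv \<omega>M (f x)" for x
    by (metis assms(3) inv_simps(5,6))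
  then show ?thesis
    unfolding linear_tensor_sum_act[OF assms(1)]
    by (simp add: act_def assms tensor_sum_tensor_map[OF bilinear_act_summand] flip: assms(6))
qed

lemma act_assoc: "\<nu> (\<alpha>M m) (mult c d) = \<nu> (\<nu> m c) (\<beta>C d)"
proof -
  note MV = comodule_vector_space
  \<comment> \<open>Every Sweedler sum on either side has the vector part \<open>?v m0\<close>, so
    only scalar functions of \<open>m1\<close> remain to be compared.\<close>
  let ?v = "\<lambda>x. \<alpha>M (\<alpha>M (inv \<omega>M x))"
  let ?S = "\<lambda>f. tensor_sum sM (\<lambda>m0 m1. sM (f m1) (?v m0)) (\<phi> m)"
  have "\<sigma> (\<alpha>C (inv \<omega>C a)) (\<psi>C (\<beta>C d)) = \<sigma> (\<alpha>C a) (\<beta>C (\<omega>C (\<psi>C d)))" for a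
    using sigma_simps(4)[of "\<alpha>C (inv \<omega>C a)" "\<psi>C (\<beta>C d)"] 
    by (simp add: commute_simps commute_inv_simps(1))
  then have inner: "tensor_sum sM (\<lambda>a b. sM (\<sigma> b (\<psi>C (\<psi>C c)))
      (sM (\<sigma> (\<alpha>C (inv \<omega>C a)) (\<psi>C (\<beta>C d))) w)) (\<Delta> x)
    = sM (\<sigma> (\<alpha>C x) (\<psi>C (mult c d)) + l * \<epsilon> d * \<sigma> x (\<psi>C c) + l * \<epsilon> c * \<sigma> (\<alpha>C x) (\<psi>C (\<beta>C d))) w"
    for x w
    using yang_baxter_mult[of d c x]
    by (simp add: tensor_sum_scale_left[OF MV] mult.commute)
  have alphaM_act: "\<alpha>M (\<nu> m c) = ?S (\<lambda>x. \<sigma> x (\<psi>C c)) - sM (l * \<epsilon> c) (\<alpha>M (\<alpha>M m))"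
    by (rule linear_tensor_sum_act[OF alphaM_linear])
  have "\<nu> (\<nu> m c) (\<beta>C d) =
      ?S (\<lambda>x. \<sigma> (\<alpha>C x) (\<psi>C (mult c d)) + l * \<epsilon> d * \<sigma> x (\<psi>C c) + l * \<epsilon> c * \<sigma> (\<alpha>C x) (\<psi>C (\<beta>C d)))
      - sM (l * \<epsilon> c) (?S (\<lambda>x. \<sigma> (\<alpha>C x) (\<psi>C (\<beta>C d)))) - sM (l * \<epsilon> d) (\<alpha>M (\<nu> m c))"
    unfolding act_def[of "\<nu> m c"] tensor_sum_coact_act[OF bilinear_act_summand]
      commute_inv_simps(4)[symmetric] inner counit_beta ..
  \<comment> \<open>The two sums with factor \<lambda>\<epsilon>(c) cancel.\<close>
  also have "\<dots> = ?S (\<lambda>x. \<sigma> (\<alpha>C x) (\<psi>C (mult c d))) + sM (l * \<epsilon> d) (?S (\<lambda>x. \<sigma> x (\<psi>C c)))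
      - sM (l * \<epsilon> d) (\<alpha>M (\<nu> m c))"
    unfolding M.scale_left_distrib tensor_sum_add[OF MV] M.scale_scale[symmetric]
      tensor_sum_scale[OF MV] by simp
  \<comment> \<open>The sum with factor \<lambda>\<epsilon>(d) cancels against the one in
    \<open>alphaM_act\<close>; the leftover coefficient
    \<open>l * \<epsilon> c * l * \<epsilon> d\<close> equals
    \<open>- l * \<epsilon> (mult c d)\<close> by \<open>counit_mult\<close>.\<close>
  also have "\<dots> = ?S (\<lambda>x. \<sigma> (\<alpha>C x) (\<psi>C (mult c d))) - sM (l * \<epsilon> (mult c d)) (\<alpha>M (\<alpha>M m))"
    unfolding alphaM_act M.scale_right_diff_distrib counit_mult by (simp add: mult_ac)
  also have "\<dots> = \<nu> (\<alpha>M m) (mult c d)"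
    unfolding act_def tensor_sum_coact(1)[OF bilinear_act_summand]
    unfolding commute_inv_simps(4) ..
  finally show ?thesis ..
qed

section \<open>Compatibility of the coaction with the action\<close>

lemma coact_act:
  "\<phi> (\<nu> m c) =
    tensor_add sM sC
      (tensor_add sM sC
        (tensor_map sM sC (\<lambda>c1. \<nu> (\<omega>M m) c1) \<beta>C (\<Delta> c))
        (tensor_map sM sC \<alpha>M (\<lambda>m1. mult m1 (\<psi>C c)) (\<phi> m)))
      (tensor_scale sM sC l (pure_tensor sM sC (\<alpha>M (\<omega>M m)) (\<beta>C (\<psi>C c))))"
    (is "_ = ?rhs")
proof (rule tensor_eqI[OF comodule_vector_space vector_space])
  show "\<phi> (\<nu> m c) \<in> tensor_space sM sC"
    using coact_linear by (simp add: linear_to_tensor_def)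
  show "?rhs \<in> tensor_space sM sC"
    by (simp add: tensor_add_def tensor_space_def)
  fix F :: "'m \<Rightarrow> 'c \<Rightarrow> 'k" assume F: "bilinear_map sM sC (*) F"
  note KV = vector_space_mult
  note F_simps = bilinear_mapD(4-)[OF F]
  let ?S = "\<lambda>f. tensor_sum (*) f (\<phi> m)"
  have linF: "Vector_Spaces.linear sC (*) (F a)" "Vector_Spaces.linear sM (*) (\<lambda>a. F a b)" for a b
    using F by (auto simp: bilinear_map_def)
  have linFb: "Vector_Spaces.linear sC (*) (\<lambda>y. F a (\<beta>C y))" for a
    by (simp add: Vector_Spaces.linear_iff map_simps F_simps KV vector_space)
  have bil: "bilinear_map sM sC (*) (\<lambda>m0 m1. \<sigma> m1 d * F (\<alpha>M (inv \<omega>M m0)) y)"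
    and bil2: "bilinear_map sC sC (*) (\<lambda>d1 d2. \<sigma> x d1 * F z (\<beta>C (inv \<psi>C d2)))" for d y x z
    by (intro bilinear_mapI KV vector_space comodule_vector_space;
        simp add: map_simps F_simps distrib_left distrib_right)+
  have act: "F (\<nu> (\<omega>M m) a) b = ?S (\<lambda>m0 m1. \<sigma> (\<omega>C m1) (\<psi>C a) * F (\<alpha>M m0) b)
      - l * (\<epsilon> a * F (\<alpha>M (\<omega>M m)) b)" for a b
    unfolding linear_tensor_sum_act[OF linF(2)] tensor_sum_coact(2)[OF bil] by simp
  have "tensor_sum (*) (\<lambda>a b. \<epsilon> a * F x (\<beta>C b)) (\<Delta> c) = F x (\<beta>C (\<psi>C c))" for x
    using linear_tensor_sum[OF linFb, of x "\<lambda>x y. sC (\<epsilon> x) y" "\<Delta> c"]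
    by (simp add: counit_left map_simps F_simps)
  \<comment> \<open>The left counit axiom has collapsed the \<lambda>-term, and the sums are
    exchanged so that the one over \<open>\<phi> m\<close> stands outside, as in
    \<open>second\<close>.\<close>
  then have first: "tensor_sum (*) (\<lambda>a b. F (\<nu> (\<omega>M m) a) (\<beta>C b)) (\<Delta> c) =
      ?S (\<lambda>m0 m1. tensor_sum (*) (\<lambda>a b. \<sigma> (\<omega>C m1) (\<psi>C a) * F (\<alpha>M m0) (\<beta>C b)) (\<Delta> c))
      - l * F (\<alpha>M (\<omega>M m)) (\<beta>C (\<psi>C c))"
    unfolding act tensor_sum_diff[OF KV] tensor_sum_scale[OF KV]
    by (simp add: tensor_sum_swap[OF KV, of _ "\<phi> m"])
  have "F (\<alpha>M x) (mult y (\<psi>C c)) =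
      tensor_sum (*) (\<lambda>a b. \<sigma> b (\<psi>C (\<psi>C c)) * F (\<alpha>M x) (\<alpha>C (inv \<omega>C a))) (\<Delta> y)
      - tensor_sum (*) (\<lambda>a b. \<sigma> (\<omega>C y) (\<psi>C a) * F (\<alpha>M x) (\<beta>C b)) (\<Delta> c)
      - l * \<epsilon> c * F (\<alpha>M x) (\<alpha>C y)" for x y
    unfolding linear_mu_sigma[OF linF(1)] tensor_sum_comult[OF bil2] by (simp add: counit_psi)
  then have second: "?S (\<lambda>x y. F (\<alpha>M x) (mult y (\<psi>C c))) =
      ?S (\<lambda>x y. tensor_sum (*) (\<lambda>a b. \<sigma> b (\<psi>C (\<psi>C c)) * F (\<alpha>M x) (\<alpha>C (inv \<omega>C a))) (\<Delta> y))
      - ?S (\<lambda>x y. tensor_sum (*) (\<lambda>a b. \<sigma> (\<omega>C y) (\<psi>C a) * F (\<alpha>M x) (\<beta>C b)) (\<Delta> c))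
      - l * \<epsilon> c * ?S (\<lambda>x y. F (\<alpha>M x) (\<alpha>C y))"
    by (simp add: tensor_sum_diff[OF KV] tensor_sum_scale[OF KV])
  \<comment> \<open>The double sum over \<open>\<phi> m\<close> and \<open>\<Delta> c\<close>
    cancels between \<open>first\<close> and \<open>second\<close>, and the \<lambda>-term of
    \<open>first\<close> cancels the pure tensor. What is left of \<open>second\<close> is the
    formula for the coaction on \<open>\<nu> m c\<close>.\<close>
  show "tensor_sum (*) F (\<phi> (\<nu> m c)) = tensor_sum (*) F ?rhs"
    unfolding tensor_sum_coact_act[OF F] tensor_sum_tensor_add[OF F] tensor_sum_tensor_map[OF F]
      tensor_sum_tensor_scale[OF F] tensor_sum_pure_tensor[OF F] first second
    by simp
qed

end

theorem theorem2p54: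
  fixes l :: "'k::field"
    and sC :: "'k \<Rightarrow> 'c::ab_group_add \<Rightarrow> 'c"
    and \<Delta> :: "'c \<Rightarrow> ('c, 'c, 'k) tensor"
    and \<epsilon> :: "'c \<Rightarrow> 'k"
    and \<alpha>C \<beta>C \<psi>C \<omega>C :: "'c \<Rightarrow> 'c"
    and \<sigma> :: "'c \<Rightarrow> 'c \<Rightarrow> 'k"
    and sM :: "'k \<Rightarrow> 'm::ab_group_add \<Rightarrow> 'm"
    and \<phi> :: "'m \<Rightarrow> ('m, 'c, 'k) tensor"
    and \<alpha>M \<beta>M \<psi>M \<omega>M :: "'m \<Rightarrow> 'm"
    and \<nu> :: "'m \<Rightarrow> 'c \<Rightarrow> 'm"
  assumes "coquasitriangular_infBH_bialgebra l sC \<Delta> \<epsilon> \<alpha>C \<beta>C \<psi>C \<omega>C \<sigma>"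
    and "right_comodule sC \<Delta> \<psi>C \<omega>C sM \<phi> \<psi>M \<omega>M"
    and "bij \<omega>M"
    and "Vector_Spaces.linear sM sM \<alpha>M"
    and "Vector_Spaces.linear sM sM \<beta>M"
    and "\<alpha>M \<circ> \<omega>M = \<omega>M \<circ> \<alpha>M"
    and "\<And>m. \<phi> (\<alpha>M m) = tensor_map sM sC \<alpha>M \<alpha>C (\<phi> m)"
    \<comment> \<open>The source does not list the next five hypotheses, but without them the conclusion can fail:
      its axioms on \<open>\<beta>M\<close> and its commutation axioms do not follow from the hypotheses above.\<close>
    and "\<alpha>M \<circ> \<beta>M = \<beta>M \<circ> \<alpha>M"
    and "\<alpha>M \<circ> \<psi>M = \<psi>M \<circ> \<alpha>M"
    and "\<beta>M \<circ> \<psi>M = \<psi>M \<circ> \<beta>M"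
    and "\<beta>M \<circ> \<omega>M = \<omega>M \<circ> \<beta>M"
    and "\<And>m. \<phi> (\<beta>M m) = tensor_map sM sC \<beta>M \<beta>C (\<phi> m)"
    and "\<And>m c. \<nu> m c =
      tensor_sum sM (\<lambda>m0 m1. sM (\<sigma> m1 (\<psi>C c)) (\<alpha>M (inv \<omega>M m0))) (\<phi> m) - sM (l * \<epsilon> c) (\<alpha>M m)"
  shows "right_infBH_Hopf_module l sC
    (mu_sigma l sC \<Delta> \<epsilon> \<alpha>C \<beta>C \<psi>C \<omega>C \<sigma>) \<Delta> \<alpha>C \<beta>C \<psi>C \<omega>C
    sM \<nu> \<phi> \<alpha>M \<beta>M \<psi>M \<omega>M"
proof -
  interpret coquasitriangular_coaction l sC \<Delta> \<epsilon> \<alpha>C \<beta>C \<psi>C \<omega>C \<sigma> sM \<phi> \<psi>M \<omega>M \<alpha>M \<nu>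
    by (intro coquasitriangular_coaction.intro coquasitriangular_coaction_axioms.intro assms)
  have commute: "\<alpha>M (\<beta>M m) = \<beta>M (\<alpha>M m)" "\<beta>M (\<omega>M m) = \<omega>M (\<beta>M m)" for m
    using assms(8,11) by (simp_all add: fun_eq_iff)
  have "\<alpha>M (\<nu> m c) = \<nu> (\<alpha>M m) (\<alpha>C c)" for m c
    by (rule map_act[OF alphaM_linear])
      (simp_all add: commute_simps alphaM_coact counit_alpha)
  \<comment> \<open>Here colinearity of \<open>\<beta>M\<close> and its commutation with
    \<open>\<alpha>M\<close> and \<open>\<omega>M\<close> enter.\<close>
  moreover have "\<beta>M (\<nu> m c) = \<nu> (\<beta>M m) (\<beta>C c)" for m c
    by (rule map_act[OF assms(5)])
      (simp_all add: commute commute_simps assms(12) counit_beta)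
  ultimately have "right_module sC (mu_sigma l sC \<Delta> \<epsilon> \<alpha>C \<beta>C \<psi>C \<omega>C \<sigma>) \<alpha>C \<beta>C sM \<nu> \<alpha>M \<beta>M"
    by (intro right_module.intro comodule_vector_space act_bilinear assms(4,5,8) act_assoc)
  moreover have "f \<circ> g = g \<circ> f" if "f \<in> {\<alpha>M, \<beta>M, \<psi>M, \<omega>M}" "g \<in> {\<alpha>M, \<beta>M, \<psi>M, \<omega>M}" for f g
    using that assms(6,8-11) psiM_omegaM by auto
  ultimately show ?thesis
    by (intro right_infBH_Hopf_module.intro assms(2) right_infBH_Hopf_module_axioms.intro coact_act)
qed

end
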